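(* For every fixed $0<\delta<1$, \[ \limsup_{d\to\infty}B_{[]}^{\rm sh}(d,\delta)^{1/d}\le\limsup_{d\to\infty}B_{\rm cov}^{\rm sh}(d,\delta)^{1/d}\le F(A_\delta). \]
   Context: For given $d\in\mathbb N$, $0<\delta<1$, define recursively $L_0=0$, $c_i:=\log(1+\delta e^{L_i})$, $L_{i+1}:=\min\{L_i+c_i/\sqrt{d\delta},\ d\log(\delta^{-1})\}$, and let $J$ be the first index with $L_J=d\log(\delta^{-1})$ (it exists). For $0\le i<J$ put \[ r_i^-:=\max\Bigl\{0,\Bigl\lceil d\Bigl(\frac{L_i}{c_i}-1\Bigr)\Bigr\rceil\Bigr\},\qquad r_i^+:=\Bigl\lceil\frac{dL_{i+1}}{c_i}\Bigr\rceil-1, \] $\mathcal A_i:=\{\boldsymbol n\in\mathbb N_0^d: r_i^-\le\sum_{j=1}^dn_j\le r_i^+\}$, $\boldsymbol 1=(1,\dots,1)$, and \[ B_{[]}^{\rm sh}(d,\delta):=d+\sum_{i=0}^{J-1}|\mathcal A_i|,\qquad B_{\rm cov}^{\rm sh}(d,\delta):=d+\sum_{i=0}^{J-1}|\mathcal A_i\cup(\mathcal A_i+\boldsymbol1)| . \] Moreover \[ A_\delta:=\sup_{L\ge0}\frac{L}{\log(1+\delta e^L)},\qquad F(t):=\frac{(1+t)^{1+t}}{t^t}\ (t>0),\qquad F(0):=1 . \] *)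

theory Defs
  imports Complex_Main "HOL-Library.Extended_Real"
begin

primrec Lsh :: "nat \<Rightarrow> real \<Rightarrow> nat \<Rightarrow> real" where
  "Lsh d \<delta> 0 = 0"
| "Lsh d \<delta> (Suc i) =
     min (Lsh d \<delta> i + ln (1 + \<delta> * exp (Lsh d \<delta> i)) / sqrt (real d * \<delta>))
         (real d * ln (1 / \<delta>))"

definition csh :: "nat \<Rightarrow> real \<Rightarrow> nat \<Rightarrow> real" where
  "csh d \<delta> i = ln (1 + \<delta> * exp (Lsh d \<delta> i))"

text \<open>The least index exists for \<open>0 < \<delta> < 1\<close>; see \<open>Jsh_exists\<close> below.\<close>

definition Jsh :: "nat \<Rightarrow> real \<Rightarrow> nat" where
  "Jsh d \<delta> = (LEAST j. Lsh d \<delta> j = real d * ln (1 / \<delta>))"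

definition rminus :: "nat \<Rightarrow> real \<Rightarrow> nat \<Rightarrow> int" where
  "rminus d \<delta> i = max 0 \<lceil>real d * (Lsh d \<delta> i / csh d \<delta> i - 1)\<rceil>"

definition rplus :: "nat \<Rightarrow> real \<Rightarrow> nat \<Rightarrow> int" where
  "rplus d \<delta> i = \<lceil>real d * Lsh d \<delta> (Suc i) / csh d \<delta> i\<rceil> - 1"

text \<open>Multi-indices in $\mathbb{N}_0^d$ are lists of naturals of length \<open>d\<close>;
  translation by the all-ones vector is \<open>map Suc\<close>.\<close>

definition Ash :: "nat \<Rightarrow> real \<Rightarrow> nat \<Rightarrow> nat list set" where
  "Ash d \<delta> i = {n. length n = d \<and> rminus d \<delta> i \<le> int (sum_list n) \<and>
                    int (sum_list n) \<le> rplus d \<delta> i}"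

definition Bbr_sh :: "nat \<Rightarrow> real \<Rightarrow> nat" where
  "Bbr_sh d \<delta> = d + (\<Sum>i<Jsh d \<delta>. card (Ash d \<delta> i))"

definition Bcov_sh :: "nat \<Rightarrow> real \<Rightarrow> nat" where
  "Bcov_sh d \<delta> = d + (\<Sum>i<Jsh d \<delta>. card (Ash d \<delta> i \<union> map Suc ` Ash d \<delta> i))"

text \<open>The supremum is over a nonempty set that is bounded above for \<open>0 < \<delta> < 1\<close>;
  see \<open>A_const_bdd_above\<close> below.\<close>

definition A_const :: "real \<Rightarrow> real" where
  "A_const \<delta> = (SUP L\<in>{0..}. L / ln (1 + \<delta> * exp L))"

definition F_fun :: "real \<Rightarrow> real" where
  "F_fun t = (if t = 0 then 1 else (1 + t) powr (1 + t) / t powr t)"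

lemma finite_Ash: "finite (Ash d \<delta> i)"
proof (rule finite_subset)
  show "Ash d \<delta> i \<subseteq> {n. set n \<subseteq> {..nat (rplus d \<delta> i)} \<and> length n = d}"
  proof
    fix n assume n: "n \<in> Ash d \<delta> i"
    have "x \<le> nat (rplus d \<delta> i)" if "x \<in> set n" for x
      using member_le_sum_list[OF that] n unfolding Ash_def by auto
    with n show "n \<in> {n. set n \<subseteq> {..nat (rplus d \<delta> i)} \<and> length n = d}"
      by (auto simp: Ash_def)
  qed
qed (rule finite_lists_length_eq, simp)

lemma Jsh_exists:
  assumes "0 < \<delta>" "\<delta> < 1"
  shows "\<exists>j. Lsh d \<delta> j = real d * ln (1 / \<delta>)"
proof (cases "d = 0")
  case True
  then show ?thesis by (intro exI[of _ 0]) simp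
next
  case False
  define M where "M = real d * ln (1 / \<delta>)"
  define a where "a = ln (1 + \<delta>) / sqrt (real d * \<delta>)"
  have M: "M > 0" unfolding M_def using assms False by simp
  have a: "a > 0" unfolding a_def using assms False by simp
  have step: "min (real j * a) M \<le> Lsh d \<delta> j \<and> Lsh d \<delta> j \<ge> 0 \<and> Lsh d \<delta> j \<le> M" for j
  proof (induction j)
    case 0
    then show ?case using M by simp
  next
    case (Suc j)
    have "\<delta> * 1 \<le> \<delta> * exp (Lsh d \<delta> j)"
      using Suc assms by (intro mult_left_mono) auto
    then have "ln (1 + \<delta>) \<le> ln (1 + \<delta> * exp (Lsh d \<delta> j))"
      using assms by (intro ln_mono) auto
    then have "a \<le> ln (1 + \<delta> * exp (Lsh d \<delta> j)) / sqrt (real d * \<delta>)"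
      unfolding a_def using assms by (intro divide_right_mono) auto
    then have "Lsh d \<delta> (Suc j) \<ge> min (Lsh d \<delta> j + a) M"
      by (simp add: M_def)
    moreover have "Lsh d \<delta> (Suc j) \<le> M" by (simp add: M_def)
    moreover have "real (Suc j) * a = real j * a + a" by (simp add: algebra_simps)
    ultimately show ?case using Suc a M by linarith
  qed
  obtain j where "M < real j * a" using a reals_Archimedean3 by blast
  with step[of j] show ?thesis unfolding M_def by (intro exI[of _ j]) linarith
qed

lemma A_const_bdd_above:
  fixes \<delta> :: real
  assumes "0 < \<delta>" "\<delta> < 1"
  shows "bdd_above ((\<lambda>L. L / ln (1 + \<delta> * exp L)) ` {0..})"
proof (rule bdd_aboveI2)
  fix L :: real
  assume "L \<in> {0..}"
  then have L: "0 \<le> L" by simp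
  have "\<delta> * 1 \<le> \<delta> * exp L" using L assms by (intro mult_left_mono) auto
  then have ge1: "ln (1 + \<delta>) \<le> ln (1 + \<delta> * exp L)"
    using assms by (intro ln_mono) auto
  have pos: "ln (1 + \<delta>) > 0" using assms by simp
  have "ln (\<delta> * exp L) \<le> ln (1 + \<delta> * exp L)"
    using assms by (intro ln_mono) (auto intro: add_pos_pos)
  then have ge2: "L - ln (1 / \<delta>) \<le> ln (1 + \<delta> * exp L)"
    using assms by (simp add: ln_mult ln_div)
  have lpos: "ln (1 / \<delta>) > 0" using assms by simp
  show "L / ln (1 + \<delta> * exp L) \<le> 2 + 2 * ln (1 / \<delta>) / ln (1 + \<delta>)"
  proof (cases "L \<ge> 2 * ln (1 / \<delta>)")
    case True
    with ge2 have "L \<le> 2 * ln (1 + \<delta> * exp L)" by linarith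
    with ge1 pos have "L / ln (1 + \<delta> * exp L) \<le> 2" by (simp add: divide_le_eq)
    moreover have "2 * ln (1 / \<delta>) / ln (1 + \<delta>) \<ge> 0"
      using pos lpos by (intro divide_nonneg_nonneg) linarith+
    ultimately show ?thesis by linarith
  next
    case False
    then have "L / ln (1 + \<delta> * exp L) \<le> 2 * ln (1 / \<delta>) / ln (1 + \<delta>)"
      using L ge1 pos by (intro frac_le) auto
    then show ?thesis by linarith
  qed
qed

end

theory Submission imports Defs begin

text \<open>
  A shell \<open>Ash d \<delta> i\<close> lies in the simplex of all multi-indices \<open>n\<close> of length \<open>d\<close> with
  \<open>sum_list n \<le> d * t\<close>, where \<open>t = A_const \<delta> + 1 / sqrt (d * \<delta>)\<close>: one step of the recursion
  raises \<open>Lsh\<close> by at most \<open>csh / sqrt (d * \<delta>)\<close>, and \<open>Lsh / csh\<close> is one of the quotients whose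
  supremum is \<open>A_const \<delta>\<close>. Such a simplex has at most \<open>F_fun t ^ d\<close> points
  (\<open>card_simplex_le_F_fun_power\<close>), by the usual entropy bound for a binomial coefficient.
  The translate of a shell has the same size as the shell, and there are only polynomially
  many shells, since each step but the last raises \<open>Lsh\<close> by at least a constant multiple of \<open>1 / sqrt d\<close>
  on its way from \<open>0\<close> to \<open>d * ln (1 / \<delta>)\<close> (\<open>Jsh_le\<close>). Hence \<open>Bcov_sh d \<delta>\<close> is at most a
  polynomial in \<open>d\<close> times \<open>F_fun t ^ d\<close>. Under the \<open>d\<close>-th root the polynomial tends to \<open>1\<close>,
  while \<open>t\<close> tends to \<open>A_const \<delta> > 0\<close>, where \<open>F_fun\<close> is continuous. The comparison of the
  two limits superior is the inclusion of \<open>A\<close> in \<open>A \<union> map Suc ` A\<close>.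
\<close>

section \<open>The rate function\<close>

lemma F_fun_ge_1:
  assumes "t > 0"
  shows "F_fun t \<ge> 1"
proof -
  have "t powr t \<le> (1 + t) powr t"
    using assms by (intro powr_mono2) auto
  also have "\<dots> \<le> (1 + t) powr (1 + t)"
    using assms by (intro powr_mono) auto
  finally show ?thesis
    using assms by (simp add: F_fun_def)
qed

lemma tendsto_F_fun:
  assumes "(f \<longlongrightarrow> a) G" and "a > 0"
  shows "((\<lambda>x. F_fun (f x)) \<longlongrightarrow> F_fun a) G"
proof -
  have "((\<lambda>x. (1 + f x) powr (1 + f x) / f x powr f x) \<longlongrightarrow>
          (1 + a) powr (1 + a) / a powr a) G"
    using assms by (intro tendsto_intros) auto
  moreover have "\<forall>\<^sub>F x in G. (1 + f x) powr (1 + f x) / f x powr f x = F_fun (f x)"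
    using order_tendstoD(1)[OF assms] by eventually_elim (simp add: F_fun_def)
  ultimately have "((\<lambda>x. F_fun (f x)) \<longlongrightarrow> (1 + a) powr (1 + a) / a powr a) G"
    by (rule Lim_transform_eventually)
  then show ?thesis
    using assms(2) by (simp add: F_fun_def)
qed

section \<open>Lattice points in a simplex\<close>

text \<open>Prepending the slack \<open>r - sum_list n\<close> as an extra coordinate turns the inequality into
  an equation, for which the number of solutions is known.\<close>

lemma card_sum_list_le:
  "card {n :: nat list. length n = d \<and> sum_list n \<le> r} \<le> (r + d) choose r"
proof -
  let ?E = "{n :: nat list. length n = Suc d \<and> sum_list n = r}"
  have card_E: "card ?E = (r + d) choose r"
    using card_length_sum_list[of "Suc d" r] by simp
  then have fin: "finite ?E"
    by (intro card_ge_0_finite) simp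
  have "card {n :: nat list. length n = d \<and> sum_list n \<le> r} \<le> card ?E"
    by (rule card_inj_on_le[where f = "\<lambda>n. (r - sum_list n) # n", OF _ _ fin])
       (auto simp: inj_on_def)
  with card_E show ?thesis by simp
qed

text \<open>With \<open>p = t / (1 + t)\<close> and \<open>q = 1 / (1 + t)\<close>, a single term of the binomial expansion of
  \<open>(p + q) ^ (r + d) = 1\<close> bounds the binomial coefficient by \<open>p ^ (-r) * q ^ (-d)\<close>. This \<open>p\<close>
  puts the largest term of the expansion near \<open>r = d * t\<close>, so little is lost.\<close>

lemma choose_le_F_fun_power:
  assumes t: "t > 0" and r: "real r \<le> real d * t"
  shows "real ((r + d) choose r) \<le> F_fun t ^ d"
proof -
  define p where "p = t / (1 + t)"
  define q where "q = 1 / (1 + t)"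
  have pq: "p > 0" "q > 0" "p + q = 1"
    using t by (auto simp: p_def q_def field_simps)
  have "real ((r + d) choose r) * p ^ r * q ^ (r + d - r)
          \<le> (\<Sum>k\<le>r + d. real ((r + d) choose k) * p ^ k * q ^ (r + d - k))"
    using pq by (intro member_le_sum) auto
  also have "\<dots> = (p + q) ^ (r + d)"
    by (simp add: binomial_ring)
  finally have "real ((r + d) choose r) * p ^ r * q ^ d \<le> 1"
    using pq by simp
  then have "real ((r + d) choose r) \<le> (1 / p) ^ r * (1 / q) ^ d"
    using pq by (simp add: field_simps)
  also have "(1 / p) ^ r = (1 / p) powr real r"
    using pq by (simp add: powr_realpow)
  also have "(1 / p) powr real r \<le> (1 / p) powr (real d * t)"
    using r t by (intro powr_mono) (auto simp: p_def field_simps)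
  also have "(1 / p) powr (real d * t) * (1 / q) ^ d = ((1 / p) powr t * (1 / q)) ^ d"
    using pq by (simp add: power_divide powr_power mult.commute)
  also have "(1 / p) powr t * (1 / q) = F_fun t"
    using t by (simp add: p_def q_def F_fun_def powr_divide powr_add)
  finally show ?thesis
    using pq by (simp add: mult_right_mono)
qed

lemma card_simplex_le_F_fun_power:
  assumes t: "t > 0"
  shows "finite {n :: nat list. length n = d \<and> real (sum_list n) \<le> real d * t}"
    and "real (card {n :: nat list. length n = d \<and> real (sum_list n) \<le> real d * t}) \<le> F_fun t ^ d"
proof -
  define r where "r = nat \<lfloor>real d * t\<rfloor>"
  have r: "real r \<le> real d * t"
    using t by (simp add: r_def)
  have eq: "{n :: nat list. length n = d \<and> real (sum_list n) \<le> real d * t}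
              = {n. length n = d \<and> sum_list n \<le> r}"
    using t by (auto simp: r_def le_nat_floor le_nat_iff le_floor_iff)
  show "finite {n :: nat list. length n = d \<and> real (sum_list n) \<le> real d * t}"
    unfolding eq
    by (rule finite_subset[OF _ finite_lists_length_eq[of "{..r}" d]])
       (use member_le_sum_list order_trans in fastforce)+
  have "real (card {n :: nat list. length n = d \<and> sum_list n \<le> r}) \<le> real ((r + d) choose r)"
    using card_sum_list_le by (rule of_nat_mono)
  also have "\<dots> \<le> F_fun t ^ d"
    using t r by (rule choose_le_F_fun_power)
  finally show "real (card {n :: nat list. length n = d \<and> real (sum_list n) \<le> real d * t}) \<le> F_fun t ^ d"
    by (simp only: eq)
qed

section \<open>The number of shells\<close>

lemma Lsh_nonneg:
  assumes "0 < \<delta>" "\<delta> < 1"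
  shows "Lsh d \<delta> i \<ge> 0"
  using assms by (induction i) (auto simp: min_def)

lemma csh_ge:
  assumes "0 < \<delta>" "\<delta> < 1"
  shows "csh d \<delta> i \<ge> ln (1 + \<delta>)"
proof -
  have "\<delta> * 1 \<le> \<delta> * exp (Lsh d \<delta> i)"
    using Lsh_nonneg[OF assms, of d i] assms by (intro mult_left_mono) auto
  then show ?thesis
    unfolding csh_def using assms by (intro ln_mono) auto
qed

lemma csh_pos:
  assumes "0 < \<delta>" "\<delta> < 1"
  shows "csh d \<delta> i > 0"
  using csh_ge[OF assms, of d i] assms ln_gt_zero[of "1 + \<delta>"] by linarith

lemma Lsh_lower_bound:
  assumes "0 < \<delta>" "\<delta> < 1" "d > 0"
  shows "min (real j * (ln (1 + \<delta>) / sqrt (real d * \<delta>))) (real d * ln (1 / \<delta>)) \<le> Lsh d \<delta> j"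
proof (induction j)
  case 0
  show ?case by simp
next
  case (Suc j)
  have "ln (1 + \<delta>) / sqrt (real d * \<delta>) \<le> csh d \<delta> j / sqrt (real d * \<delta>)"
    using csh_ge[OF assms(1,2)] assms by (intro divide_right_mono) auto
  moreover have "0 \<le> ln (1 + \<delta>) / sqrt (real d * \<delta>)"
    using assms by simp
  moreover have "real (Suc j) * (ln (1 + \<delta>) / sqrt (real d * \<delta>))
      = real j * (ln (1 + \<delta>) / sqrt (real d * \<delta>)) + ln (1 + \<delta>) / sqrt (real d * \<delta>)"
    by (simp add: algebra_simps add_divide_distrib)
  moreover have "Lsh d \<delta> (Suc j)
      = min (Lsh d \<delta> j + csh d \<delta> j / sqrt (real d * \<delta>)) (real d * ln (1 / \<delta>))"
    by (simp add: csh_def)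
  ultimately show ?case
    using Suc by linarith
qed

lemma Jsh_le:
  assumes "0 < \<delta>" "\<delta> < 1" "d > 0"
  shows "real (Jsh d \<delta>) \<le> ln (1 / \<delta>) / ln (1 + \<delta>) * real d ^ 2 + 1"
proof -
  define a where "a = ln (1 + \<delta>) / sqrt (real d * \<delta>)"
  define M where "M = real d * ln (1 / \<delta>)"
  define j where "j = nat \<lceil>M / a\<rceil>"
  have a: "a > 0" and M: "M > 0"
    using assms by (auto simp: a_def M_def)
  then have Ma: "M / a > 0" by simp
  have "M / a \<le> real j"
    using Ma by (simp add: j_def)
  then have "M \<le> real j * a"
    using a by (simp add: field_simps)
  then have "M \<le> Lsh d \<delta> j"
    using Lsh_lower_bound[OF assms, of j] by (simp add: a_def M_def)
  moreover have "Lsh d \<delta> j \<le> M"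
    using M by (cases j) (auto simp: M_def)
  ultimately have "Lsh d \<delta> j = real d * ln (1 / \<delta>)"
    by (simp add: M_def)
  then have "Jsh d \<delta> \<le> j"
    unfolding Jsh_def by (rule Least_le)
  then have "real (Jsh d \<delta>) \<le> real j"
    by simp
  also have "real j \<le> M / a + 1"
    using Ma unfolding j_def by linarith
  also have "M / a = ln (1 / \<delta>) / ln (1 + \<delta>) * (real d * sqrt (real d * \<delta>))"
    using assms by (simp add: M_def a_def)
  also have "\<dots> \<le> ln (1 / \<delta>) / ln (1 + \<delta>) * real d ^ 2"
  proof (rule mult_left_mono)
    have "real d * \<delta> \<le> real d * real d"
      using assms by (intro mult_left_mono) auto
    then have "sqrt (real d * \<delta>) \<le> real d"
      by (intro real_le_lsqrt) (auto simp: power2_eq_square)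
    then show "real d * sqrt (real d * \<delta>) \<le> real d ^ 2"
      by (simp add: power2_eq_square mult_left_mono)
    have "ln (1 / \<delta>) > 0" and "ln (1 + \<delta>) > 0"
      using assms by auto
    then show "0 \<le> ln (1 / \<delta>) / ln (1 + \<delta>)"
      by simp
  qed
  finally show ?thesis by simp
qed

section \<open>The size of the shells\<close>

lemma quotient_le_A_const:
  assumes "0 < \<delta>" "\<delta> < 1" "L \<ge> 0"
  shows "L / ln (1 + \<delta> * exp L) \<le> A_const \<delta>"
  unfolding A_const_def using assms A_const_bdd_above by (intro cSUP_upper) auto

lemma A_const_pos:
  assumes "0 < \<delta>" "\<delta> < 1"
  shows "A_const \<delta> > 0"
proof -
  have "0 < 1 / ln (1 + \<delta> * exp 1)"
    using assms by (simp add: add_pos_pos)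
  also have "\<dots> \<le> A_const \<delta>"
    using quotient_le_A_const[OF assms, of 1] by simp
  finally show ?thesis .
qed

lemma card_Ash_le:
  assumes "0 < \<delta>" "\<delta> < 1" "d > 0"
  shows "real (card (Ash d \<delta> i)) \<le> F_fun (A_const \<delta> + 1 / sqrt (real d * \<delta>)) ^ d"
proof -
  define s where "s = sqrt (real d * \<delta>)"
  define t where "t = A_const \<delta> + 1 / s"
  define L where "L = Lsh d \<delta> i"
  define c where "c = csh d \<delta> i"
  have s: "s > 0" using assms by (simp add: s_def)
  then have t: "t > 0"
    using A_const_pos[OF assms(1,2)] by (simp add: t_def add_pos_pos)
  have c: "c > 0" using csh_pos assms by (simp add: c_def)
  have "Lsh d \<delta> (Suc i) \<le> L + c / s"
    by (simp add: L_def c_def s_def csh_def)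
  then have "Lsh d \<delta> (Suc i) / c \<le> L / c + 1 / s"
    using c s by (simp add: field_simps)
  also have "\<dots> \<le> t"
    using quotient_le_A_const[OF assms(1,2) Lsh_nonneg[OF assms(1,2)], of d i]
    by (simp add: t_def L_def c_def csh_def)
  finally have "real d * (Lsh d \<delta> (Suc i) / c) \<le> real d * t"
    using assms by (intro mult_left_mono) auto
  then have "real_of_int (rplus d \<delta> i) \<le> real d * t"
    unfolding rplus_def c_def times_divide_eq_right by linarith
  then have "Ash d \<delta> i \<subseteq> {n. length n = d \<and> real (sum_list n) \<le> real d * t}"
    by (auto simp: Ash_def)
  then have "card (Ash d \<delta> i) \<le> card {n :: nat list. length n = d \<and> real (sum_list n) \<le> real d * t}"
    by (intro card_mono card_simplex_le_F_fun_power(1) t)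
  then have "real (card (Ash d \<delta> i)) \<le> real (card {n :: nat list. length n = d \<and> real (sum_list n) \<le> real d * t})"
    by (rule of_nat_mono)
  also have "\<dots> \<le> F_fun t ^ d"
    using t by (rule card_simplex_le_F_fun_power(2))
  finally show ?thesis
    by (simp add: t_def s_def)
qed

lemma Bbr_sh_le_Bcov_sh: "Bbr_sh d \<delta> \<le> Bcov_sh d \<delta>"
  unfolding Bbr_sh_def Bcov_sh_def
  by (intro add_left_mono sum_mono card_mono) (auto simp: finite_Ash)

lemma Bcov_sh_le:
  assumes "0 < \<delta>" "\<delta> < 1" "d > 0"
  shows "real (Bcov_sh d \<delta>) \<le> (3 + 2 * (ln (1 / \<delta>) / ln (1 + \<delta>))) * real d ^ 2
           * F_fun (A_const \<delta> + 1 / sqrt (real d * \<delta>)) ^ d"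
proof -
  define K where "K = ln (1 / \<delta>) / ln (1 + \<delta>)"
  define f where "f = F_fun (A_const \<delta> + 1 / sqrt (real d * \<delta>)) ^ d"
  have f: "f \<ge> 1"
    unfolding f_def using A_const_pos[OF assms(1,2)] assms
    by (intro one_le_power F_fun_ge_1) (auto intro: add_pos_pos)
  have shell: "real (card (Ash d \<delta> i \<union> map Suc ` Ash d \<delta> i)) \<le> 2 * f" for i
  proof -
    have "card (Ash d \<delta> i \<union> map Suc ` Ash d \<delta> i) \<le> card (Ash d \<delta> i) + card (map Suc ` Ash d \<delta> i)"
      by (rule card_Un_le)
    also have "\<dots> \<le> 2 * card (Ash d \<delta> i)"
      using card_image_le[OF finite_Ash, of "map Suc" d \<delta> i] by simp
    finally have "real (card (Ash d \<delta> i \<union> map Suc ` Ash d \<delta> i)) \<le> 2 * real (card (Ash d \<delta> i))"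
      by linarith
    then show ?thesis
      using card_Ash_le[OF assms, of i] unfolding f_def by linarith
  qed
  have d: "1 \<le> real d" using assms by simp
  have d2: "real d \<le> real d ^ 2" using d by (rule self_le_power) simp
  have "real (Bcov_sh d \<delta>)
      = real d + (\<Sum>i<Jsh d \<delta>. real (card (Ash d \<delta> i \<union> map Suc ` Ash d \<delta> i)))"
    by (simp add: Bcov_sh_def)
  also have "\<dots> \<le> real d + real (Jsh d \<delta>) * (2 * f)"
    using sum_mono[of "{..<Jsh d \<delta>}", OF shell] by simp
  also have "\<dots> \<le> real d * f + real (Jsh d \<delta>) * (2 * f)"
    using f mult_left_mono[OF f, of "real d"] by simp
  also have "\<dots> = (real d + 2 * real (Jsh d \<delta>)) * f"
    by (simp add: algebra_simps)
  also have "\<dots> \<le> ((3 + 2 * K) * real d ^ 2) * f"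
  proof (rule mult_right_mono)
    have "real (Jsh d \<delta>) \<le> K * real d ^ 2 + 1"
      using Jsh_le[OF assms] by (simp add: K_def)
    moreover have "(3 + 2 * K) * real d ^ 2 = 3 * real d ^ 2 + 2 * (K * real d ^ 2)"
      by (simp add: algebra_simps)
    ultimately show "real d + 2 * real (Jsh d \<delta>) \<le> (3 + 2 * K) * real d ^ 2"
      using d d2 by linarith
  qed (use f in simp)
  finally show ?thesis
    by (simp only: K_def f_def)
qed

section \<open>The exponential growth rate\<close>

theorem corollary5p6:
  fixes \<delta> :: real
  assumes "0 < \<delta>" and "\<delta> < 1"
  shows "limsup (\<lambda>d. ereal (root d (real (Bbr_sh d \<delta>))))
           \<le> limsup (\<lambda>d. ereal (root d (real (Bcov_sh d \<delta>))))
       \<and> limsup (\<lambda>d. ereal (root d (real (Bcov_sh d \<delta>)))) \<le> ereal (F_fun (A_const \<delta>))"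
proof
  show "limsup (\<lambda>d. ereal (root d (real (Bbr_sh d \<delta>))))
          \<le> limsup (\<lambda>d. ereal (root d (real (Bcov_sh d \<delta>))))"
    by (intro Limsup_mono eventually_mono[OF eventually_gt_at_top[of 0]])
       (simp add: Bbr_sh_le_Bcov_sh)
next
  define C where "C = 3 + 2 * (ln (1 / \<delta>) / ln (1 + \<delta>))"
  define t where "t = (\<lambda>d :: nat. A_const \<delta> + 1 / sqrt (real d * \<delta>))"
  define b where "b = (\<lambda>d. root d C * (root d (real d)) ^ 2 * F_fun (t d))"
  have "ln (1 / \<delta>) > 0" and "ln (1 + \<delta>) > 0"
    using assms by auto
  then have "ln (1 / \<delta>) / ln (1 + \<delta>) > 0"
    by simp
  then have C: "C > 0"
    by (simp add: C_def)
  have "filterlim (\<lambda>d. sqrt (real d * \<delta>)) at_top sequentially"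
    using assms
    by (intro filterlim_compose[OF sqrt_at_top] filterlim_at_top_mult_tendsto_pos[OF tendsto_const]
          filterlim_real_sequentially) auto
  then have "t \<longlonglongrightarrow> A_const \<delta> + 0"
    unfolding t_def
    by (intro tendsto_add tendsto_const tendsto_divide_0[OF tendsto_const]
          filterlim_at_top_imp_at_infinity)
  then have "(\<lambda>d. F_fun (t d)) \<longlonglongrightarrow> F_fun (A_const \<delta>)"
    using A_const_pos[OF assms] by (intro tendsto_F_fun) auto
  then have "b \<longlonglongrightarrow> 1 * 1 ^ 2 * F_fun (A_const \<delta>)"
    unfolding b_def by (intro tendsto_mult tendsto_power LIMSEQ_root LIMSEQ_root_const C)
  then have lim: "(\<lambda>d. ereal (b d)) \<longlonglongrightarrow> ereal (F_fun (A_const \<delta>))"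
    by simp
  have "\<forall>\<^sub>F d in sequentially. ereal (root d (real (Bcov_sh d \<delta>))) \<le> ereal (b d)"
    using eventually_gt_at_top[of 0]
  proof eventually_elim
    case (elim d)
    have "t d > 0"
      unfolding t_def using A_const_pos[OF assms] assms elim by (intro add_pos_pos) auto
    then have F: "F_fun (t d) \<ge> 0"
      using F_fun_ge_1[of "t d"] by linarith
    have "root d (real (Bcov_sh d \<delta>)) \<le> root d (C * real d ^ 2 * F_fun (t d) ^ d)"
      using Bcov_sh_le[OF assms elim] elim by (simp add: C_def t_def)
    also have "\<dots> = b d"
      using elim F by (simp add: b_def real_root_mult real_root_power real_root_power_cancel)
    finally show ?case by simp
  qed
  then have "limsup (\<lambda>d. ereal (root d (real (Bcov_sh d \<delta>)))) \<le> limsup (\<lambda>d. ereal (b d))"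
    by (rule Limsup_mono)
  also have "\<dots> = ereal (F_fun (A_const \<delta>))"
    using lim by (intro lim_imp_Limsup) auto
  finally show "limsup (\<lambda>d. ereal (root d (real (Bcov_sh d \<delta>)))) \<le> ereal (F_fun (A_const \<delta>))" .
qed

end
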